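(* Let $a,b,m\in\mathbb{Z}$ with $a\ge 2$, $m>1$, $\gcd(b,m)=1$, and $b\ge -(a-2)m-2$, and let $S=S_{a,b}(m)$ and $d=(a-1)m+b$. Let $n$ be the smallest positive integer such that $A_n\ge m$, and let $A=\{A_1,\ldots,A_{n-1}\}$. Then \[ \operatorname{Ap}(S)=\left\{d\ell+\mathsf{m}_A(\ell)\,m\ \middle|\ 0\le \ell\le m-1\right\}. \]
   Context: $\mathbb{N}=\{0,1,2,\dots\}$. Let $T_{a,b}(z)=az+b$, with $T_{a,b}^i$ its $i$-fold composition ($T_{a,b}^0$ the identity), and let $S_{a,b}(m)=\langle T_{a,b}^i(m)\mid i\ge 0\rangle$ be the submonoid of $(\mathbb{N},+)$ generated by the orbit of $m$; under the stated hypotheses it is a numerical semigroup (finite complement in $\mathbb{N}$) whose smallest positive element is $m$. Set $A_i=(a^i-1)/(a-1)$ for $i\ge 0$ (so $A_1=1$); since $m>1$, $n\ge 2$. The Apéry set is $\operatorname{Ap}(S)=\{s\in S\mid s-m\notin S\}$. The index $\ell$ ranges over integers. $\mathsf{m}_A(\ell)$ is the minimum factorization length of $\ell$ with respect to $A$, i.e. the minimum of $\sum_{i=1}^{n-1}u_i$ over all $(u_1,\ldots,u_{n-1})\in\mathbb{N}^{n-1}$ with $\ell=\sum_{i=1}^{n-1}u_iA_i$. *)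

theory Defs
  imports Main
begin

definition affine_map :: "int \<Rightarrow> int \<Rightarrow> int \<Rightarrow> int" where
  "affine_map a b z = a * z + b"

inductive_set submonoid_generated :: "'a::monoid_add set \<Rightarrow> 'a set" for G where
  zero: "0 \<in> submonoid_generated G"
| gen: "x \<in> G \<Longrightarrow> x \<in> submonoid_generated G"
| add: "x \<in> submonoid_generated G \<Longrightarrow> y \<in> submonoid_generated G \<Longrightarrow> x + y \<in> submonoid_generated G"

text \<open>The submonoid is taken inside the integers, so that subtraction in the Apery set does not
  truncate. It consists of nonnegative integers in the situation of interest: see
  \<open>orbit_semigroup_nonneg\<close>.\<close>

definition orbit_semigroup :: "int \<Rightarrow> int \<Rightarrow> int \<Rightarrow> int set" where
  "orbit_semigroup a b m = submonoid_generated {(affine_map a b ^^ i) m |i. True}"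

definition apery_set :: "int set \<Rightarrow> int \<Rightarrow> int set" where
  "apery_set S m = {s \<in> S. s - m \<notin> S}"

text \<open>The division is exact, see \<open>repunit_mult\<close>.\<close>

definition repunit :: "int \<Rightarrow> nat \<Rightarrow> int" where
  "repunit a i = (a ^ i - 1) div (a - 1)"

text \<open>Minimum of \<open>u 1 + \<dots> + u (n - 1)\<close> over all factorizations
  \<open>l = u 1 * A 1 + \<dots> + u (n - 1) * A (n - 1)\<close>; the values of \<open>u\<close> outside
  \<open>{1..<n}\<close> are irrelevant. The value is meaningful only if \<open>l\<close> has a factorization, which
  is automatic for \<open>l \<ge> 0\<close>, \<open>A 1 = 1\<close> and \<open>n \<ge> 2\<close>.\<close>

definition min_fact_length :: "(nat \<Rightarrow> int) \<Rightarrow> nat \<Rightarrow> int \<Rightarrow> nat" where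
  "min_fact_length A n l =
     (LEAST k. \<exists>u :: nat \<Rightarrow> nat. l = (\<Sum>i\<in>{1..<n}. int (u i) * A i) \<and> k = (\<Sum>i\<in>{1..<n}. u i))"

lemma repunit_mult: "(a - 1) * repunit a i = a ^ i - 1"
proof -
  have "(a - 1) dvd (a ^ i - 1)"
    by (metis dvd_triv_left power_diff_1_eq)
  thus ?thesis by (simp add: repunit_def)
qed

lemma orbit_ge:
  assumes "a \<ge> 2" "m > 1" "b \<ge> - (a - 2) * m - 2"
  shows "(affine_map a b ^^ i) m \<ge> m"
proof (induction i)
  case (Suc i)
  let ?x = "(affine_map a b ^^ i) m"
  have "a * m \<le> a * ?x" using Suc assms by (intro mult_left_mono) auto
  moreover have "a * m + b \<ge> m" using assms by (simp add: algebra_simps)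
  moreover have "(affine_map a b ^^ Suc i) m = a * ?x + b" by (simp add: affine_map_def)
  ultimately show ?case by linarith
qed simp

lemma orbit_semigroup_nonneg:
  assumes "a \<ge> 2" "m > 1" "b \<ge> - (a - 2) * m - 2"
    and "s \<in> orbit_semigroup a b m"
  shows "s \<ge> 0"
  using assms(4) unfolding orbit_semigroup_def
proof induction
  case (gen x)
  then obtain i where "x = (affine_map a b ^^ i) m" by blast
  then show ?case using orbit_ge[OF assms(1-3), of i] assms(2) by linarith
qed auto

end

theory Submission
  imports Defs
begin

text \<open>Each orbit element is \<open>T\<^sup>i(m) = m + d A\<^sub>i\<close> with \<open>A\<^sub>0 = 0\<close>, so \<open>S\<close> consists of the numbers
  \<open>d l + k m\<close> where \<open>l\<close> is a sum of at most \<open>k\<close> repunits. As \<open>d\<close> is coprime to \<open>m\<close>, two such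
  representations of one number differ by \<open>l' = l + t m\<close>, \<open>k = k' + t d\<close>. If \<open>0 \<le> l < m\<close> and
  \<open>t > 0\<close>, then \<open>k' \<ge> 1\<close> and \<open>d \<ge> m - 2\<close> give \<open>k \<ge> m - 1 \<ge> l\<close>, which is at least the minimum
  factorization length of \<open>l\<close>. Hence for \<open>0 \<le> l < m\<close> the number \<open>d l + k m\<close> lies in \<open>S\<close> exactly
  if \<open>k\<close> is at least that length.\<close>

section \<open>Repunits and the affine orbit\<close>

lemma repunit_0 [simp]: "repunit a 0 = 0"
  by (simp add: repunit_def)

lemma repunit_Suc:
  assumes "a \<ge> 2"
  shows "repunit a (Suc i) = a * repunit a i + 1"
proof -
  have "(a - 1) * repunit a (Suc i) = (a - 1) * (a * repunit a i + 1)"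
    using repunit_mult[of a "Suc i"] repunit_mult[of a i] by (simp add: algebra_simps)
  then show ?thesis using assms by simp
qed

lemma repunit_ge:
  assumes "a \<ge> 2"
  shows "repunit a i \<ge> int i"
proof (induction i)
  case (Suc i)
  have "1 * repunit a i \<le> a * repunit a i"
    using Suc assms by (intro mult_right_mono) auto
  then show ?case using Suc by (simp add: repunit_Suc[OF assms])
qed simp

lemma repunit_nonneg: "a \<ge> 2 \<Longrightarrow> repunit a i \<ge> 0"
  using repunit_ge[of a i] by simp

lemma mono_repunit:
  assumes "a \<ge> 2"
  shows "mono (repunit a)"
proof (rule monoI, erule lift_Suc_mono_le[rotated])
  fix i
  have "1 * repunit a i \<le> a * repunit a i"
    using repunit_nonneg[of a] assms by (intro mult_right_mono) auto
  then show "repunit a i \<le> repunit a (Suc i)" by (simp add: repunit_Suc[OF assms])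
qed

lemma affine_map_funpow:
  assumes "a \<ge> 2"
  shows "(affine_map a b ^^ i) m = m + ((a - 1) * m + b) * repunit a i"
proof (induction i)
  case (Suc i)
  have "(affine_map a b ^^ Suc i) m = a * (affine_map a b ^^ i) m + b"
    by (simp add: affine_map_def)
  then show ?case unfolding Suc by (simp add: repunit_Suc[OF assms] algebra_simps)
qed simp

section \<open>Semigroup elements as lists of orbit indices\<close>

lemma submonoid_generated_range:
  "submonoid_generated {f i |i. True} = range (\<lambda>xs. sum_list (map f xs))"
proof (intro equalityI subsetI)
  fix x assume "x \<in> submonoid_generated {f i |i. True}"
  then show "x \<in> range (\<lambda>xs. sum_list (map f xs))"
  proof induction
    case zero
    show ?case by (rule range_eqI[of _ _ "[]"]) simp
  next
    case (gen x)
    then obtain i where "x = f i" by blast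
    then show ?case by (intro range_eqI[of _ _ "[i]"]) simp
  next
    case (add x y)
    then obtain xs ys where "x = sum_list (map f xs)" "y = sum_list (map f ys)" by blast
    then show ?case by (intro range_eqI[of _ _ "xs @ ys"]) simp
  qed
next
  fix x assume "x \<in> range (\<lambda>xs. sum_list (map f xs))"
  then obtain xs where "x = sum_list (map f xs)" by blast
  moreover have "sum_list (map f xs) \<in> submonoid_generated {f i |i. True}"
  proof (induction xs)
    case (Cons i xs)
    have "f i \<in> submonoid_generated {f i |i. True}"
      by (rule submonoid_generated.gen) blast
    then show ?case using Cons by (simp add: submonoid_generated.add)
  qed (simp add: submonoid_generated.zero)
  ultimately show "x \<in> submonoid_generated {f i |i. True}" by simp
qed

text \<open>Each list entry contributes one \<open>m\<close> plus \<open>d\<close> times a repunit.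
  An entry 0 contributes only \<open>m\<close>, so the length merely bounds the number of nonzero
  repunits used.\<close>

lemma mem_orbit_semigroup_iff:
  assumes "a \<ge> 2"
  shows "s \<in> orbit_semigroup a b m \<longleftrightarrow>
    (\<exists>xs. s = int (length xs) * m + ((a - 1) * m + b) * sum_list (map (repunit a) xs))"
proof -
  have "sum_list (map (\<lambda>i. (affine_map a b ^^ i) m) xs) =
      int (length xs) * m + ((a - 1) * m + b) * sum_list (map (repunit a) xs)" for xs
    by (induction xs) (simp_all add: affine_map_funpow[OF assms] algebra_simps)
  then show ?thesis
    unfolding orbit_semigroup_def submonoid_generated_range by auto
qed

section \<open>Minimum factorization lengths\<close>

lemma sum_list_map_eq_sum_count_list:
  fixes f :: "'a \<Rightarrow> 'b::comm_semiring_1"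
  assumes "finite I" "set xs \<subseteq> I"
  shows "sum_list (map f xs) = (\<Sum>i\<in>I. of_nat (count_list xs i) * f i)"
  using assms(2)
proof (induction xs)
  case (Cons x xs)
  have "(\<Sum>i\<in>I. of_nat (count_list (x # xs) i) * f i) =
      (\<Sum>i\<in>I. of_nat (count_list xs i) * f i + (if i = x then f i else 0))"
    by (intro sum.cong) (auto simp: algebra_simps)
  also have "\<dots> = (\<Sum>i\<in>I. of_nat (count_list xs i) * f i) + f x"
    using assms(1) Cons.prems by (simp add: sum.distrib)
  finally show ?case using Cons by (simp add: add.commute)
qed simp

text \<open>Taking \<open>u i\<close> copies of each index \<open>i\<close>, and conversely counting
  occurrences, puts factorizations in the same list form as semigroup elements, with the length as
  number of summands.\<close>

lemma factorization_iff_list: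
  "(\<exists>u :: nat \<Rightarrow> nat. l = (\<Sum>i\<in>{1..<n}. int (u i) * A i) \<and> k = (\<Sum>i\<in>{1..<n}. u i)) \<longleftrightarrow>
   (\<exists>xs. set xs \<subseteq> {1..<n} \<and> l = sum_list (map A xs) \<and> k = length xs)"
proof (intro iffI; elim exE conjE)
  fix u :: "nat \<Rightarrow> nat"
  assume u: "l = (\<Sum>i\<in>{1..<n}. int (u i) * A i)" "k = (\<Sum>i\<in>{1..<n}. u i)"
  define xs where "xs = concat (map (\<lambda>i. replicate (u i) i) [1..<n])"
  have "set xs \<subseteq> {1..<n}" by (auto simp: xs_def)
  moreover have "sum_list (map A (concat (map (\<lambda>i. replicate (u i) i) is))) =
      (\<Sum>i\<leftarrow>is. int (u i) * A i)" for "is"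
    by (induction "is") (simp_all add: sum_list_replicate)
  then have "sum_list (map A xs) = l"
    by (simp add: xs_def u(1) interv_sum_list_conv_sum_set_nat)
  moreover have "length xs = k"
    by (simp add: xs_def u(2) length_concat o_def interv_sum_list_conv_sum_set_nat)
  ultimately show "\<exists>xs. set xs \<subseteq> {1..<n} \<and> l = sum_list (map A xs) \<and> k = length xs"
    by blast
next
  fix xs assume xs: "set xs \<subseteq> {1..<n}" "l = sum_list (map A xs)" "k = length xs"
  have "l = (\<Sum>i\<in>{1..<n}. int (count_list xs i) * A i)"
    using xs by (simp add: sum_list_map_eq_sum_count_list)
  moreover have "k = (\<Sum>i\<in>{1..<n}. count_list xs i)"
    using xs(1,3) sum_list_map_eq_sum_count_list[of "{1..<n}" xs "\<lambda>_. 1::nat"]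
    by (simp add: sum_list_triv)
  ultimately show "\<exists>u :: nat \<Rightarrow> nat. l = (\<Sum>i\<in>{1..<n}. int (u i) * A i) \<and> k = (\<Sum>i\<in>{1..<n}. u i)"
    by blast
qed

lemma min_fact_length_le:
  "set xs \<subseteq> {1..<n} \<Longrightarrow> l = sum_list (map A xs) \<Longrightarrow> min_fact_length A n l \<le> length xs"
  unfolding min_fact_length_def factorization_iff_list by (rule Least_le) blast

text \<open>The given factorization \<open>ys\<close> makes the set under \<open>LEAST\<close>
  nonempty.\<close>

lemma min_fact_length_attained:
  assumes "set ys \<subseteq> {1..<n}" "l = sum_list (map A ys)"
  obtains xs where "set xs \<subseteq> {1..<n}" "l = sum_list (map A xs)" "min_fact_length A n l = length xs"
proof -
  have "\<exists>xs. set xs \<subseteq> {1..<n} \<and> l = sum_list (map A xs) \<and> min_fact_length A n l = length xs"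
    unfolding min_fact_length_def factorization_iff_list by (rule LeastI_ex) (use assms in blast)
  then show ?thesis using that by blast
qed

lemma min_fact_length_repunit_le:
  assumes a: "a \<ge> 2" and l: "l < repunit a n" "l = sum_list (map (repunit a) xs)"
  shows "min_fact_length (repunit a) n l \<le> length xs"
proof -
  let ?ys = "filter (\<lambda>i. i > 0) xs"
  have "sum_list (map (repunit a) ?ys) = l"
    unfolding l(2) by (induction xs) auto
  moreover have "i < n" if "i \<in> set xs" for i
  proof -
    have "repunit a i \<le> l"
      unfolding l(2) using that repunit_nonneg[OF a]
      by (intro member_le_sum_list) auto
    then show ?thesis using l(1) monoD[OF mono_repunit[OF a], of n i] by linarith
  qed
  then have "set ?ys \<subseteq> {1..<n}" by auto
  ultimately have "min_fact_length (repunit a) n l \<le> length ?ys"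
    by (intro min_fact_length_le) auto
  also have "\<dots> \<le> length xs" by (rule length_filter_le)
  finally show ?thesis .
qed

theorem corollary4p7:
  fixes a b m d :: int and n :: nat and S :: "int set"
  assumes "a \<ge> 2" and "m > 1" and "gcd b m = 1" and "b \<ge> - (a - 2) * m - 2"
    and "S = orbit_semigroup a b m"
    and "d = (a - 1) * m + b"
    and "n = (LEAST k. k > 0 \<and> repunit a k \<ge> m)"
  shows "apery_set S m =
    {d * l + int (min_fact_length (repunit a) n l) * m |l. 0 \<le> l \<and> l \<le> m - 1}"
proof -
  let ?A = "repunit a"
  let ?L = "min_fact_length ?A n"
  \<comment> \<open>A witness for the \<open>LEAST\<close> defining \<open>n\<close>.\<close>
  have "nat m > 0 \<and> ?A (nat m) \<ge> m"
    using repunit_ge[OF assms(1), of "nat m"] assms(2) by simp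
  then have n: "n > 0" "?A n \<ge> m"
    unfolding assms(7) by (rule LeastI2, simp)+
  have A1: "?A 1 = 1" using repunit_Suc[OF assms(1), of 0] by simp
  then have n2: "n \<ge> 2"
    using n assms(2) by (cases "n = 1") auto
  have d: "d \<ge> m - 2" "d \<ge> 0"
    using assms(2,4) by (simp_all add: assms(6) algebra_simps)
  \<comment> \<open>\<open>d\<close> is congruent to \<open>b\<close> modulo
    \<open>m\<close>.\<close>
  have "gcd m d = 1"
    using assms(3) gcd_add_mult[of m "a - 1" b] by (simp add: assms(6) gcd.commute)
  then have cop: "coprime m d" by (simp add: coprime_iff_gcd_eq_1)
  have S: "s \<in> S \<longleftrightarrow> (\<exists>xs. s = int (length xs) * m + d * sum_list (map ?A xs))" for s
    unfolding assms(5,6) by (rule mem_orbit_semigroup_iff[OF assms(1)])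
  have key: "d * r + j * m \<in> S \<longleftrightarrow> int (?L r) \<le> j" if r: "0 \<le> r" "r \<le> m - 1" for r j
  proof -
    \<comment> \<open>As \<open>A 1 = 1\<close>, this is a factorization of \<open>r\<close> of
      length \<open>r\<close>: the minimum is attained and is at most \<open>r\<close>.\<close>
    define zs where "zs = replicate (nat r) (1::nat)"
    have zs: "set zs \<subseteq> {1..<n}" "r = sum_list (map ?A zs)" "length zs = nat r"
      using n2 r A1 by (auto simp: zs_def sum_list_replicate)
    show ?thesis
    proof
      assume "d * r + j * m \<in> S"
      then obtain xs where xs: "d * r + j * m = int (length xs) * m + d * sum_list (map ?A xs)"
        using S by blast
      define l where "l = sum_list (map ?A xs)"
      have l0: "l \<ge> 0"
        unfolding l_def using repunit_nonneg[OF assms(1)] by (intro sum_list_nonneg) auto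
      have "d * (l - r) = m * (j - int (length xs))"
        using xs by (simp add: l_def algebra_simps)
      then have "m dvd d * (l - r)" by simp
      then have "m dvd l - r" using cop by (simp add: coprime_dvd_mult_right_iff)
      then obtain t where t: "l = r + m * t" by (metis dvdE diff_eq_eq add.commute)
      \<comment> \<open>\<open>m * t = l - r\<close> \<ge> \<open>- r\<close> >
        \<open>- m\<close>.\<close>
      have "m * (-1) < m * t" using t l0 r by linarith
      then have t0: "t \<ge> 0"
        using assms(2) mult_less_cancel_left_pos[of m "-1" t] by simp
      have "m * j = m * (int (length xs) + d * t)"
        using xs by (simp add: l_def[symmetric] t algebra_simps)
      then have j: "j = int (length xs) + d * t" using assms(2) by simp
      show "int (?L r) \<le> j"
      proof (cases "t = 0")
        case True
        then have "r = sum_list (map ?A xs)" using t l_def by simp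
        then have "?L r \<le> length xs"
          using r n by (intro min_fact_length_repunit_le assms(1)) auto
        then show ?thesis using j True by simp
      next
        case False
        then have t1: "t \<ge> 1" using t0 by simp
        have "m * 1 \<le> m * t" using t1 assms(2) by (intro mult_left_mono) auto
        \<comment> \<open>A positive sum needs a nonempty list; this one summand closes the gap
          between \<open>d\<close> \<ge> \<open>m - 2\<close> and the required
          \<open>m - 1\<close>.\<close>
        then have "l > 0" using t r assms(2) by linarith
        then have "xs \<noteq> []" by (auto simp: l_def)
        then have "int (length xs) \<ge> 1" by (cases xs) auto
        moreover have "d * 1 \<le> d * t" using t1 d by (intro mult_left_mono) auto
        moreover have "int (?L r) \<le> r"
          using min_fact_length_le[OF zs(1,2)] zs(3) r by simp
        ultimately show ?thesis using j d r by linarith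
      qed
    next
      assume j: "int (?L r) \<le> j"
      obtain xs where xs: "r = sum_list (map ?A xs)" "?L r = length xs"
        using min_fact_length_attained[OF zs(1,2)] .
      show "d * r + j * m \<in> S"
        unfolding S
        \<comment> \<open>Padding with index 0, the generator \<open>m\<close> itself, raises the
          length to \<open>j\<close> and leaves the repunit sum unchanged.\<close>
        by (rule exI[of _ "xs @ replicate (nat (j - int (?L r))) 0"])
          (use j xs in \<open>simp add: sum_list_replicate\<close>)
    qed
  qed
  have key': "d * r + j * m - m \<in> S \<longleftrightarrow> int (?L r) \<le> j - 1" if "0 \<le> r" "r \<le> m - 1" for r j
    using key[OF that, of "j - 1"] by (simp add: algebra_simps)
  show ?thesis
  proof (intro equalityI subsetI)
    fix s assume "s \<in> apery_set S m"
    then have s: "s \<in> S" "s - m \<notin> S" by (auto simp: apery_set_def)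
    then obtain xs where xs: "s = int (length xs) * m + d * sum_list (map ?A xs)"
      using S by blast
    define l where "l = sum_list (map ?A xs)"
    define r where "r = l mod m"
    \<comment> \<open>Reducing \<open>l\<close> modulo \<open>m\<close> turns the quotient into
      \<open>d * (l div m)\<close> further copies of \<open>m\<close>.\<close>
    define j where "j = int (length xs) + d * (l div m)"
    have r: "0 \<le> r" "r \<le> m - 1" using assms(2) by (simp_all add: r_def)
    have "l = r + m * (l div m)" by (simp add: r_def)
    then have "d * l = d * r + d * (l div m) * m"
      by (metis distrib_left mult.assoc mult.commute)
    then have sj: "s = d * r + j * m"
      by (simp add: xs l_def[symmetric] j_def distrib_right)
    \<comment> \<open>Membership of \<open>s\<close> gives \<open>?L r\<close> \<le>
      \<open>j\<close>; non-membership of \<open>s - m\<close> gives \<open>?L r\<close> >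
      \<open>j - 1\<close>.\<close>
    have "j = int (?L r)" using s key[OF r, of j] key'[OF r, of j] by (simp add: sj)
    then show "s \<in> {d * l + int (?L l) * m |l. 0 \<le> l \<and> l \<le> m - 1}"
      using sj r by blast
  next
    fix s assume "s \<in> {d * l + int (?L l) * m |l. 0 \<le> l \<and> l \<le> m - 1}"
    then obtain r where "0 \<le> r" "r \<le> m - 1" "s = d * r + int (?L r) * m" by blast
    then show "s \<in> apery_set S m"
      using key[of r "int (?L r)"] key'[of r "int (?L r)"] by (simp add: apery_set_def)
  qed
qed

end
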